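(* As $n\to\infty$, $f(n,3,3)\ge\Omega\left(\left(\frac{\ln n}{\ln\ln n}\right)^{1/2}\right)$; that is, there are constants $c>0$ and $n_0$ such that $f(n,3,3)\ge c\left(\frac{\ln n}{\ln\ln n}\right)^{1/2}$ for all $n\ge n_0$.
   Context: A $3$-digraph $G$ consists of a finite vertex set $V(G)$ and an edge set $E(G)$ whose elements are ordered triples of distinct vertices. A $(3,k)$-tournament is a $3$-digraph $G$ such that for every $3$-element set $S\subseteq V(G)$, exactly $k$ of the $6$ orderings of $S$ are edges of $G$. The tight path $P^{(3)}_s$ is the $3$-digraph with $s$ distinct vertices $v_1,\ldots,v_s$ whose edges are exactly the triples $(v_i,v_{i+1},v_{i+2})$, $1\le i\le s-2$ (no edges if $s<3$). A $3$-digraph $G$ contains $P^{(3)}_s$ if there is an injection of its vertices into $V(G)$ mapping edges to edges. $f(n,3,k)$ is the maximum integer $s$ such that every $n$-vertex $(3,k)$-tournament contains a copy of $P^{(3)}_s$. $\ln$ is the natural logarithm. *)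

theory Defs
  imports Complex_Main
begin

record 'v digraph3 =
  verts :: "'v set"
  edges :: "('v \<times> 'v \<times> 'v) set"

definition is_digraph3 :: "'v digraph3 \<Rightarrow> bool" where
  "is_digraph3 G \<longleftrightarrow> finite (verts G) \<and>
     (\<forall>(x, y, z) \<in> edges G. {x, y, z} \<subseteq> verts G \<and> x \<noteq> y \<and> y \<noteq> z \<and> x \<noteq> z)"

definition orderings :: "'v set \<Rightarrow> ('v \<times> 'v \<times> 'v) set" where
  "orderings S = {(x, y, z). x \<noteq> y \<and> y \<noteq> z \<and> x \<noteq> z \<and> {x, y, z} = S}"

definition tournament3 :: "nat \<Rightarrow> 'v digraph3 \<Rightarrow> bool" where
  "tournament3 k G \<longleftrightarrow> is_digraph3 G \<and>
     (\<forall>S \<subseteq> verts G. card S = 3 \<longrightarrow> card (orderings S \<inter> edges G) = k)"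

definition tight_path :: "nat \<Rightarrow> nat digraph3" where
  "tight_path s = \<lparr>verts = {1..s}, edges = {(i, i + 1, i + 2) |i. 1 \<le> i \<and> i + 2 \<le> s}\<rparr>"

definition contains_copy :: "'v digraph3 \<Rightarrow> 'w digraph3 \<Rightarrow> bool" where
  "contains_copy G H \<longleftrightarrow> (\<exists>\<phi>. inj_on \<phi> (verts H) \<and> \<phi> ` verts H \<subseteq> verts G \<and>
     (\<forall>(x, y, z) \<in> edges H. (\<phi> x, \<phi> y, \<phi> z) \<in> edges G))"

definition path_forced :: "'v itself \<Rightarrow> nat \<Rightarrow> nat \<Rightarrow> nat \<Rightarrow> bool" where
  "path_forced _ n k s \<longleftrightarrow> (\<forall>G :: 'v digraph3. tournament3 k G \<and> card (verts G) = n \<longrightarrow>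
     contains_copy G (tight_path s))"

text \<open>
  A definition cannot quantify over vertex types, so the vertices are taken to be natural
  numbers. No generality is lost: see \<open>path_forced_transfer\<close> below. The
  maximum exists whenever \<open>k \<le> 6\<close>: see \<open>path_forced_finite\<close> and
  \<open>path_forced_0\<close>.
\<close>

definition tight_path_number :: "nat \<Rightarrow> nat \<Rightarrow> nat" where
  "tight_path_number n k = Max {s. path_forced TYPE(nat) n k s}"

lemma path_forced_0: "path_forced TYPE('v) n k 0"
  by (auto simp: path_forced_def contains_copy_def tight_path_def)

lemma card_orderings:
  assumes "card S = 3"
  shows "finite (orderings S)" "card (orderings S) = 6"
proof -
  obtain a b c where S: "S = {a, b, c}" "a \<noteq> b" "b \<noteq> c" "a \<noteq> c"
    using assms by (auto simp: card_3_iff)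
  have eq: "orderings S = {(a,b,c), (a,c,b), (b,a,c), (b,c,a), (c,a,b), (c,b,a)}"
  proof (intro equalityI subsetI)
    fix e assume "e \<in> orderings S"
    then obtain x y z where e: "e = (x, y, z)" "x \<noteq> y" "y \<noteq> z" "x \<noteq> z" "{x, y, z} = S"
      by (auto simp: orderings_def)
    then have "x \<in> {a, b, c}" "y \<in> {a, b, c}" "z \<in> {a, b, c}"
      using S(1) by blast+
    then show "e \<in> {(a,b,c), (a,c,b), (b,a,c), (b,c,a), (c,a,b), (c,b,a)}"
      using e(1-4) by auto
  qed (use S in \<open>auto simp: orderings_def insert_commute\<close>)
  show "finite (orderings S)" "card (orderings S) = 6"
    unfolding eq using S(2-) by auto
qed

lemma tournament3_exists:
  assumes "k \<le> 6"
  shows "\<exists>G :: nat digraph3. tournament3 k G \<and> card (verts G) = n"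
proof -
  have "\<exists>T \<subseteq> orderings S. card T = k" if "card S = 3" for S :: "nat set"
    using card_orderings[OF that] assms by (metis obtain_subset_with_card_n)
  then obtain T where T: "T S \<subseteq> orderings S" "card (T S) = k" if "card S = 3" for S :: "nat set"
    by metis
  define G where "G = \<lparr>verts = {..<n}, edges = \<Union>(T ` {S. S \<subseteq> {..<n} \<and> card S = 3})\<rparr>"
  have E: "\<exists>S \<subseteq> {..<n}. card S = 3 \<and> e \<in> T S \<and> e \<in> orderings S" if "e \<in> edges G" for e
    using that T(1) unfolding G_def by auto
  have G: "is_digraph3 G"
    unfolding is_digraph3_def
  proof (intro conjI ballI, goal_cases)
    case 1
    show ?case by (simp add: G_def)
  next
    case (2 e)
    obtain S where S: "S \<subseteq> {..<n}" "e \<in> orderings S"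
      using E[OF 2] by blast
    obtain x y z where e: "e = (x, y, z)" by (cases e)
    have "x \<noteq> y \<and> y \<noteq> z \<and> x \<noteq> z" "{x, y, z} = S"
      using S(2) unfolding e orderings_def by simp_all
    then show ?case
      using S(1) unfolding e G_def by auto
  qed
  have "orderings S \<inter> edges G = T S" if S: "S \<subseteq> {..<n}" "card S = 3" for S
  proof (intro equalityI subsetI)
    fix e assume e: "e \<in> orderings S \<inter> edges G"
    then obtain S' where S': "e \<in> T S'" "e \<in> orderings S'"
      using E by blast
    have "S' = S"
      using e S'(2) unfolding orderings_def by force
    then show "e \<in> T S" using S'(1) by simp
  next
    fix e assume "e \<in> T S"
    then show "e \<in> orderings S \<inter> edges G"
      using T(1)[OF S(2)] S unfolding G_def by auto
  qed
  then have "tournament3 k G"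
    using G T(2) by (simp add: tournament3_def G_def)
  moreover have "card (verts G) = n" by (simp add: G_def)
  ultimately show ?thesis by blast
qed

lemma path_forced_finite:
  assumes "k \<le> 6"
  shows "finite {s. path_forced TYPE(nat) n k s}"
proof -
  obtain G :: "nat digraph3" where G: "tournament3 k G" "card (verts G) = n"
    using tournament3_exists[OF assms] by blast
  have "s \<le> n" if "path_forced TYPE(nat) n k s" for s
  proof -
    have "contains_copy G (tight_path s)"
      using that G unfolding path_forced_def by blast
    then obtain \<phi> where "inj_on \<phi> {1..s}" "\<phi> ` {1..s} \<subseteq> verts G"
      unfolding contains_copy_def tight_path_def digraph3.simps by blast
    moreover have "finite (verts G)"
      using G(1) unfolding tournament3_def is_digraph3_def by blast
    ultimately have "card {1..s} \<le> card (verts G)"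
      by (rule card_inj_on_le)
    then show ?thesis using G(2) by simp
  qed
  then show ?thesis
    by (meson finite_nat_set_iff_bounded_le mem_Collect_eq)
qed

lemma path_forced_transfer:
  assumes "path_forced TYPE(nat) n k s"
  shows "path_forced TYPE('v) n k s"
  unfolding path_forced_def
proof (intro allI impI, elim conjE)
  fix G :: "'v digraph3"
  assume G: "tournament3 k G" "card (verts G) = n"
  have fin: "finite (verts G)" and
    edg: "\<And>x y z. (x,y,z) \<in> edges G \<Longrightarrow>
      x \<in> verts G \<and> y \<in> verts G \<and> z \<in> verts G \<and> x \<noteq> y \<and> y \<noteq> z \<and> x \<noteq> z"
    using G by (auto simp: tournament3_def is_digraph3_def)
  obtain h :: "'v \<Rightarrow> nat" where h: "inj_on h (verts G)"
    using finite_imp_inj_to_nat_seg[OF fin] by blast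
  define g where "g = inv_into (verts G) h"
  have gh: "g (h x) = x" if "x \<in> verts G" for x
    using that h by (simp add: g_def)
  let ?m = "\<lambda>(x,y,z). (h x, h y, h z)"
  define H where "H = \<lparr>verts = h ` verts G, edges = ?m ` edges G\<rparr>"
  have "is_digraph3 H"
    unfolding is_digraph3_def H_def using fin edg h
    by (auto simp: inj_on_eq_iff)
  moreover have "card (orderings S \<inter> edges H) = k" if S: "S \<subseteq> verts H" "card S = 3" for S
  proof -
    obtain S' where S': "S' \<subseteq> verts G" "S = h ` S'"
      using S(1) by (auto simp: H_def subset_image_iff)
    have inj': "inj_on h S'" using h S'(1) inj_on_subset by blast
    have c: "card S' = 3" using S(2) S'(2) card_image[OF inj'] by simp
    have "orderings S \<inter> edges H = ?m ` (orderings S' \<inter> edges G)"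
    proof (intro equalityI subsetI)
      fix e assume e: "e \<in> orderings S \<inter> edges H"
      then obtain x y z where xyz: "(x,y,z) \<in> edges G" "e = (h x, h y, h z)"
        by (auto simp: H_def)
      have V: "{x,y,z} \<subseteq> verts G" using edg xyz(1) by auto
      have "h ` {x,y,z} = h ` S'" using e xyz(2) S'(2) by (auto simp: orderings_def)
      then have "{x,y,z} = S'" using inj_on_image_eq_iff[OF h V S'(1)] by blast
      then have "(x,y,z) \<in> orderings S'" using edg[OF xyz(1)] by (auto simp: orderings_def)
      then show "e \<in> ?m ` (orderings S' \<inter> edges G)" using xyz by force
    next
      fix e assume "e \<in> ?m ` (orderings S' \<inter> edges G)"
      then obtain x y z where xyz: "(x,y,z) \<in> edges G" "e = (h x, h y, h z)"
        "(x,y,z) \<in> orderings S'" by auto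
      have "{x,y,z} = S'" using xyz(3) by (auto simp: orderings_def)
      then have "{h x, h y, h z} = S" using S'(2) by auto
      moreover have "h x \<noteq> h y \<and> h y \<noteq> h z \<and> h x \<noteq> h z"
        using edg[OF xyz(1)] h by (metis inj_on_eq_iff)
      ultimately show "e \<in> orderings S \<inter> edges H"
        using xyz(1,2) by (force simp: orderings_def H_def)
    qed
    moreover have "inj_on ?m (orderings S' \<inter> edges G)"
      by (rule inj_onI) (use edg h in \<open>auto simp: inj_on_eq_iff\<close>)
    moreover have "card (orderings S' \<inter> edges G) = k"
      using G(1) S'(1) c by (simp add: tournament3_def)
    ultimately show ?thesis by (simp add: card_image)
  qed
  ultimately have "tournament3 k H" by (simp add: tournament3_def)
  moreover have "card (verts H) = n"
    using G(2) h by (simp add: H_def card_image)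
  ultimately have "contains_copy H (tight_path s)"
    using assms by (simp add: path_forced_def)
  then obtain \<phi> where p: "inj_on \<phi> (verts (tight_path s))" "\<phi> ` verts (tight_path s) \<subseteq> verts H"
    "\<And>x y z. (x,y,z) \<in> edges (tight_path s) \<Longrightarrow> (\<phi> x, \<phi> y, \<phi> z) \<in> edges H"
    by (fastforce simp: contains_copy_def)
  have "inj_on g (verts H)" unfolding H_def by (rule inj_onI) (auto simp: gh)
  then have "inj_on (g \<circ> \<phi>) (verts (tight_path s))"
    using p(1,2) by (meson comp_inj_on inj_on_subset)
  moreover have "(g \<circ> \<phi>) ` verts (tight_path s) \<subseteq> verts G"
    using p(2) gh by (fastforce simp: H_def)
  moreover have "(g (\<phi> x), g (\<phi> y), g (\<phi> z)) \<in> edges G" if xyz: "(x,y,z) \<in> edges (tight_path s)" for x y z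
  proof -
    obtain a b c where "(a,b,c) \<in> edges G" "\<phi> x = h a" "\<phi> y = h b" "\<phi> z = h c"
      using p(3)[OF xyz] by (auto simp: H_def)
    then show ?thesis using edg[of a b c] gh by simp
  qed
  ultimately show "contains_copy G (tight_path s)"
    unfolding contains_copy_def by (intro exI[of _ "g \<circ> \<phi>"]) auto
qed

end

theory Submission
  imports Defs "HOL-Real_Asymp.Real_Asymp"
begin

text \<open>
  Order the vertices and label each pair \<open>u < x\<close> with the length of a longest tight path
  that ends in \<open>u, x\<close> and otherwise stays below \<open>x\<close>, and with the same length for the
  reversed edges. If no path has \<open>s\<close> vertices there are at most \<open>s\<^sup>2\<close> labels, and at the cost
  of a factor polynomial in \<open>s\<close> per chosen vertex one finds a set of \<open>4s\<^sup>2 + 2\<close> vertices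
  on which the label of \<open>u < x\<close> depends on \<open>u\<close> only and the chosen longest path
  ending in \<open>u, x\<close> avoids the chosen vertices between \<open>u\<close> and \<open>x\<close>. Five of these vertices
  have the same label. For \<open>u < v < w\<close> among them neither \<open>uvw\<close> nor \<open>wvu\<close> is an
  edge, since it would lengthen a longest path by one; so at most one of \<open>uwv\<close>, \<open>wuv\<close>,
  \<open>vwu\<close>, \<open>vuw\<close> is missing. For \<open>u < v < w < x\<close> among them, edges \<open>uwv\<close> and \<open>wvx\<close> would
  lengthen a longest path by two, and edges \<open>vwu\<close> and \<open>xvw\<close> a longest reversed one; two
  consecutive such quadruples leave no way to choose the edges. Hence \<open>n \<ge> s^(25s\<^sup>2)\<close> forces a
  path on \<open>s\<close> vertices.
\<close>

section \<open>Homogeneous subsets\<close>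

text \<open>The pigeonhole principle in product form, which keeps division and rounding out of the
  later counts.\<close>

lemma large_fibre:
  assumes "finite A" "finite L" "L \<noteq> {}" "f ` A \<subseteq> L"
  shows "\<exists>c\<in>L. card A \<le> card L * card {x \<in> A. f x = c}"
proof (rule ccontr)
  assume "\<not> ?thesis"
  then have less: "card L * card {x \<in> A. f x = c} < card A" if "c \<in> L" for c
    using that by (auto simp: not_le)
  have "card A = card (\<Union>c\<in>L. {x \<in> A. f x = c})"
    using assms(4) by (intro arg_cong[where f = card]) auto
  also have "\<dots> \<le> (\<Sum>c\<in>L. card {x \<in> A. f x = c})"
    by (rule card_UN_le[OF assms(2)])
  finally have "card L * card A \<le> (\<Sum>c\<in>L. card L * card {x \<in> A. f x = c})"
    by (simp flip: sum_distrib_left)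
  also have "\<dots> < (\<Sum>c\<in>L. card A)"
    using assms less by (intro sum_strict_mono) auto
  finally show False by simp
qed

text \<open>Greedy colouring in increasing order: when \<open>z\<close> is reached, at most
  \<open>b\<close> of the \<open>b + 1\<close> colours occur on \<open>B z\<close>.\<close>

lemma degenerate_coloring:
  fixes C :: "'a::linorder set"
  assumes "finite C" "\<And>x. x \<in> C \<Longrightarrow> finite (B x) \<and> card (B x) \<le> b"
  shows "\<exists>f. f ` C \<subseteq> {..b::nat} \<and> (\<forall>x\<in>C. \<forall>y\<in>C. y < x \<and> y \<in> B x \<longrightarrow> f y \<noteq> f x)"
  using assms
proof (induction C rule: finite_linorder_max_induct)
  case empty
  then show ?case by auto
next
  case (insert z C)
  obtain f where f: "f ` C \<subseteq> {..b}" "\<forall>x\<in>C. \<forall>y\<in>C. y < x \<and> y \<in> B x \<longrightarrow> f y \<noteq> f x"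
    using insert.IH insert.prems by auto
  have "card (f ` B z) \<le> b" "finite (f ` B z)"
    using insert.prems[of z] card_image_le[of "B z" f] by auto
  then have "\<not> {..b} \<subseteq> f ` B z"
    by (metis card_atMost card_mono not_less_eq_eq order_trans)
  then obtain k where k: "k \<le> b" "k \<notin> f ` B z" by auto
  show ?case
  proof (intro exI conjI)
    show "(f(z := k)) ` insert z C \<subseteq> {..b}"
      using f(1) k(1) by auto
    show "\<forall>x\<in>insert z C. \<forall>y\<in>insert z C. y < x \<and> y \<in> B x \<longrightarrow> (f(z := k)) y \<noteq> (f(z := k)) x"
    proof (intro ballI impI, elim conjE)
      fix x y
      assume xy: "x \<in> insert z C" "y \<in> insert z C" "y < x" "y \<in> B x"
      \<comment> \<open>\<open>z\<close> lies above all of \<open>C\<close>, so it never takes the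
        role of the smaller vertex and colouring it leaves the old constraints intact.\<close>
      have "y \<noteq> z" using xy(1,3) insert.hyps(2) by auto
      then show "(f(z := k)) y \<noteq> (f(z := k)) x"
        using xy f(2) k(2) by (cases "x = z") auto
    qed
  qed
qed

text \<open>A most frequent colour class of the greedy colouring serves as \<open>D\<close>.\<close>

lemma degenerate_independent:
  fixes C :: "'a::linorder set"
  assumes "finite C" "\<And>x. x \<in> C \<Longrightarrow> finite (B x) \<and> card (B x) \<le> b"
  shows "\<exists>D\<subseteq>C. card C \<le> Suc b * card D \<and> (\<forall>x\<in>D. \<forall>y\<in>D. y < x \<longrightarrow> y \<notin> B x)"
proof -
  obtain f where f: "f ` C \<subseteq> {..b}" "\<forall>x\<in>C. \<forall>y\<in>C. y < x \<and> y \<in> B x \<longrightarrow> f y \<noteq> f x"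
    using degenerate_coloring[of C B b] assms by blast
  obtain c where "card C \<le> card {..b} * card {x \<in> C. f x = c}"
    using large_fibre[OF assms(1) _ _ f(1)] by auto
  then show ?thesis
    using f(2) by (intro exI[of _ "{x \<in> C. f x = c}"]) auto
qed

text \<open>Remove the minimum \<open>u\<close>, keep the vertices that share the most popular label
  with \<open>u\<close>, thin them out until none lies in \<open>B u w\<close> for a larger
  \<open>w\<close>, and recurse. The two selections cost the factors \<open>card L\<close> and
  \<open>Suc b\<close>.\<close>

lemma homogeneous_subset:
  fixes V :: "'a::linorder set" and lab :: "'a \<Rightarrow> 'a \<Rightarrow> 'c"
  assumes "finite V" "finite L" "L \<noteq> {}"
    and "\<And>u x. u \<in> V \<Longrightarrow> x \<in> V \<Longrightarrow> u < x \<Longrightarrow> lab u x \<in> L"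
    and "\<And>u x. u \<in> V \<Longrightarrow> x \<in> V \<Longrightarrow> u < x \<Longrightarrow> finite (B u x) \<and> card (B u x) \<le> b"
    and "(card L * Suc b + 1) ^ m \<le> card V"
  shows "\<exists>S\<subseteq>V. card S = m \<and>
    (\<forall>u\<in>S. \<forall>v\<in>S. \<forall>w\<in>S. u < v \<and> v < w \<longrightarrow> lab u v = lab u w \<and> v \<notin> B u w)"
  using assms
proof (induction m arbitrary: V)
  case 0
  show ?case by (intro exI[of _ "{}"]) auto
next
  case (Suc m)
  let ?q = "card L * Suc b"
  have "V \<noteq> {}" using Suc.prems(6) by auto
  define u where "u = Min V"
  define W where "W = V - {u}"
  have u: "u \<in> V" "\<And>x. x \<in> W \<Longrightarrow> u < x" "finite W" "W \<subseteq> V"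
    using \<open>V \<noteq> {}\<close> Suc.prems(1) by (auto simp: u_def W_def order_less_le)
  \<comment> \<open>The \<open>+ 1\<close> in the base pays for the removal of
    \<open>u\<close>.\<close>
  have cW: "?q * (?q + 1) ^ m \<le> card W"
  proof -
    have "?q * (?q + 1) ^ m + 1 \<le> ?q * (?q + 1) ^ m + (?q + 1) ^ m" by simp
    also have "\<dots> \<le> card V" using Suc.prems(6) by simp
    finally have "?q * (?q + 1) ^ m + 1 \<le> card V" .
    then show ?thesis using u(1) Suc.prems(1) by (simp add: W_def)
  qed
  have "lab u ` W \<subseteq> L" using Suc.prems(4) u by blast
  then obtain c where c: "card W \<le> card L * card {x \<in> W. lab u x = c}"
    using large_fibre[OF u(3) Suc.prems(2) Suc.prems(3)] by blast
  define C where "C = {x \<in> W. lab u x = c}"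
  have C: "finite C" "C \<subseteq> W" using u(3) by (auto simp: C_def)
  obtain D where D: "D \<subseteq> C" "card C \<le> Suc b * card D"
    "\<forall>x\<in>D. \<forall>y\<in>D. y < x \<longrightarrow> y \<notin> B u x"
  proof -
    have "finite (B u x) \<and> card (B u x) \<le> b" if "x \<in> C" for x
      using that C(2) u by (intro Suc.prems(5)) auto
    then show thesis
      using degenerate_independent[OF C(1), of "B u" b] that by blast
  qed
  have "?q * (?q + 1) ^ m \<le> ?q * card D"
  proof -
    have "card W \<le> card L * card C" using c by (simp add: C_def)
    also have "\<dots> \<le> ?q * card D" using mult_le_mono2[OF D(2)] by (simp only: mult.assoc)
    finally show ?thesis using cW by linarith
  qed
  then have cD: "(?q + 1) ^ m \<le> card D"
    using Suc.prems(3) Suc.prems(2) by (auto simp: card_gt_0_iff)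
  have DV: "D \<subseteq> V" "D \<subseteq> W" using D(1) C(2) u(4) by auto
  have "\<exists>S\<subseteq>D. card S = m \<and>
    (\<forall>u\<in>S. \<forall>v\<in>S. \<forall>w\<in>S. u < v \<and> v < w \<longrightarrow> lab u v = lab u w \<and> v \<notin> B u w)"
  proof (rule Suc.IH)
    show "finite D" using DV(1) Suc.prems(1) by (rule finite_subset)
    show "lab v x \<in> L" if "v \<in> D" "x \<in> D" "v < x" for v x
      by (rule Suc.prems(4)) (use that DV(1) in auto)
    show "finite (B v x) \<and> card (B v x) \<le> b" if "v \<in> D" "x \<in> D" "v < x" for v x
      by (rule Suc.prems(5)) (use that DV(1) in auto)
  qed (use Suc.prems(2,3) cD in simp_all)
  then obtain S where S: "S \<subseteq> D" "card S = m"
    "\<And>u v w. u \<in> S \<Longrightarrow> v \<in> S \<Longrightarrow> w \<in> S \<Longrightarrow> u < v \<Longrightarrow> v < w \<Longrightarrow> lab u v = lab u w \<and> v \<notin> B u w"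
    by auto
  show ?case
  proof (intro exI[of _ "insert u S"] conjI)
    show "insert u S \<subseteq> V" using u(1) S(1) DV(1) by auto
    have "finite S" using S(1) DV(2) u(3) by (meson finite_subset)
    moreover have "u \<notin> S" using S(1) DV(2) u(2) by blast
    ultimately show "card (insert u S) = Suc m" using S(2) by simp
    have min: "u < x" if "x \<in> S" for x using that S(1) DV(2) u(2) by blast
    have lab_u: "lab u x = c" if "x \<in> S" for x using that S(1) D(1) by (auto simp: C_def)
    have B_u: "v \<notin> B u w" if "v \<in> S" "w \<in> S" "v < w" for v w
      using that S(1) D(3) by blast
    show "\<forall>x\<in>insert u S. \<forall>v\<in>insert u S. \<forall>w\<in>insert u S.
        x < v \<and> v < w \<longrightarrow> lab x v = lab x w \<and> v \<notin> B x w"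
    proof (intro ballI impI, elim conjE)
      fix x v w
      assume xvw: "x \<in> insert u S" "v \<in> insert u S" "w \<in> insert u S" "x < v" "v < w"
      then have "v \<in> S" "w \<in> S" using min by fastforce+
      then show "lab x v = lab x w \<and> v \<notin> B x w"
        using xvw S(3) lab_u B_u by (cases "x = u") auto
    qed
  qed
qed

section \<open>Longest paths\<close>

text \<open>Paths are lists in reverse order: the head is the last vertex of the path.\<close>

fun tight :: "('a \<times> 'a \<times> 'a) set \<Rightarrow> 'a list \<Rightarrow> bool" where
  "tight E (x # u # t # r) \<longleftrightarrow> (t, u, x) \<in> E \<and> tight E (u # t # r)"
| "tight E _ \<longleftrightarrow> True"

lemma tight_nth:
  "tight E p \<Longrightarrow> i + 2 < length p \<Longrightarrow> (p ! (i + 2), p ! (i + 1), p ! i) \<in> E"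
proof (induction E p arbitrary: i rule: tight.induct)
  case (1 E x u t r)
  then show ?case by (cases i) auto
qed auto

definition rev_edges :: "('a \<times> 'a \<times> 'a) set \<Rightarrow> ('a \<times> 'a \<times> 'a) set" where
  "rev_edges E = {(x, y, z). (z, y, x) \<in> E}"

text \<open>Since every other vertex lies below the end \<open>x\<close>, a vertex above
  \<open>x\<close> is automatically new and can be appended without a further check.\<close>

definition paths_to :: "('a \<times> 'a \<times> 'a) set \<Rightarrow> 'a::linorder set \<Rightarrow> 'a \<Rightarrow> 'a \<Rightarrow> 'a list set" where
  "paths_to E V u x =
    {p. \<exists>r. p = x # u # r \<and> tight E p \<and> distinct p \<and> set p \<subseteq> V \<and> (\<forall>y\<in>set (u # r). y < x)}"

text \<open>One path is chosen, not just its length, because its vertex set later acts as the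
  forbidden set \<open>B u x\<close>.\<close>

definition longest_to :: "('a \<times> 'a \<times> 'a) set \<Rightarrow> 'a::linorder set \<Rightarrow> 'a \<Rightarrow> 'a \<Rightarrow> 'a list" where
  "longest_to E V u x = (ARG_MAX length p. p \<in> paths_to E V u x)"

lemma longest_to:
  fixes V :: "'a::linorder set"
  assumes "finite V" "u \<in> V" "x \<in> V" "u < x"
  shows "longest_to E V u x \<in> paths_to E V u x"
    and "p \<in> paths_to E V u x \<Longrightarrow> length p \<le> length (longest_to E V u x)"
proof -
  \<comment> \<open>The two-vertex path is vacuously tight, so there is something to maximise
    over.\<close>
  have ne: "[x, u] \<in> paths_to E V u x"
    using assms by (auto simp: paths_to_def)
  have bound: "\<forall>p. p \<in> paths_to E V u x \<longrightarrow> length p < Suc (card V)"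
  proof (intro allI impI)
    fix p assume "p \<in> paths_to E V u x"
    then have "distinct p" "set p \<subseteq> V" by (auto simp: paths_to_def)
    then show "length p < Suc (card V)"
      using assms(1) by (metis card_mono distinct_card less_Suc_eq_le)
  qed
  show "longest_to E V u x \<in> paths_to E V u x"
    "p \<in> paths_to E V u x \<Longrightarrow> length p \<le> length (longest_to E V u x)"
    unfolding longest_to_def using arg_max_nat_lemma[OF ne bound] by auto
qed

text \<open>Appending \<open>w\<close> to the chosen path ending in \<open>u, v\<close> gives a
  candidate for \<open>v, w\<close>.\<close>

lemma length_longest_step:
  assumes "finite V" "{u, v, w} \<subseteq> V" "u < v" "v < w" "(u, v, w) \<in> E"
  shows "length (longest_to E V u v) < length (longest_to E V v w)"
proof -
  have "longest_to E V u v \<in> paths_to E V u v"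
    by (rule longest_to) (use assms in auto)
  then obtain r where r: "longest_to E V u v = v # u # r" "tight E (v # u # r)"
    "distinct (v # u # r)" "set (v # u # r) \<subseteq> V" "\<forall>y\<in>set (u # r). y < v"
    by (auto simp: paths_to_def)
  then have "\<forall>y\<in>set (v # u # r). y < w" using assms(4) by auto
  then have "w # v # u # r \<in> paths_to E V v w"
    using assms(2,5) r by (auto simp: paths_to_def)
  then have "length (w # v # u # r) \<le> length (longest_to E V v w)"
    by (intro longest_to) (use assms in auto)
  then show ?thesis by (simp add: r(1))
qed

text \<open>Append \<open>v\<close> and then \<open>x\<close> to the chosen path ending in
  \<open>u, w\<close>. As \<open>v\<close> is below \<open>w\<close>, its freshness is not automatic
  and has to be assumed.\<close>

lemma length_longest_zigzag:
  assumes "finite V" "{u, v, w, x} \<subseteq> V" "u < v" "v < w" "w < x"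
    and "(u, w, v) \<in> E" "(w, v, x) \<in> E" "v \<notin> set (longest_to E V u w)"
  shows "length (longest_to E V u w) < length (longest_to E V v x)"
proof -
  have "longest_to E V u w \<in> paths_to E V u w"
    by (rule longest_to) (use assms in auto)
  then obtain r where r: "longest_to E V u w = w # u # r" "tight E (w # u # r)"
    "distinct (w # u # r)" "set (w # u # r) \<subseteq> V" "\<forall>y\<in>set (u # r). y < w"
    by (auto simp: paths_to_def)
  then have "\<forall>y\<in>set (v # w # u # r). y < x" using assms(4,5) by auto
  then have "x # v # w # u # r \<in> paths_to E V v x"
    using assms(2,6-8) r by (auto simp: paths_to_def)
  then have "length (x # v # w # u # r) \<le> length (longest_to E V v x)"
    by (intro longest_to) (use assms in auto)
  then show ?thesis by (simp add: r(1))
qed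

lemma contains_copy_tight:
  assumes "tight (edges G) p" "distinct p" "set p \<subseteq> verts G" "s \<le> length p"
  shows "contains_copy G (tight_path s)"
  unfolding contains_copy_def
\<comment> \<open>The list is stored backwards and the target vertices are numbered from 1, so
  \<open>i\<close> goes to index \<open>length p - i\<close>; the first \<open>s\<close> vertices of
  the path are used.\<close>
proof (intro exI[of _ "\<lambda>i. p ! (length p - i)"] conjI)
  show "inj_on (\<lambda>i. p ! (length p - i)) (verts (tight_path s))"
    using assms(2,4) by (auto simp: inj_on_def tight_path_def nth_eq_iff_index_eq)
  show "(\<lambda>i. p ! (length p - i)) ` verts (tight_path s) \<subseteq> verts G"
    using assms(3,4) by (force simp: tight_path_def)
  have "(p ! (length p - i), p ! (length p - (i + 1)), p ! (length p - (i + 2))) \<in> edges G"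
    if "1 \<le> i" "i + 2 \<le> s" for i
    using tight_nth[OF assms(1), of "length p - (i + 2)"] that assms(4)
    by (simp add: Suc_diff_Suc numeral_2_eq_2)
  then show "\<forall>(x, y, z)\<in>edges (tight_path s).
      (p ! (length p - x), p ! (length p - y), p ! (length p - z)) \<in> edges G"
    by (auto simp: tight_path_def)
qed

text \<open>Reversing the edges cancels the backward storage: read from its head, the list is a
  tight path of \<open>G\<close>.\<close>

lemma contains_copy_tight_rev:
  assumes "tight (rev_edges (edges G)) p" "distinct p" "set p \<subseteq> verts G" "s \<le> length p"
  shows "contains_copy G (tight_path s)"
  unfolding contains_copy_def
proof (intro exI[of _ "\<lambda>i. p ! (i - 1)"] conjI)
  show "inj_on (\<lambda>i. p ! (i - 1)) (verts (tight_path s))"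
    using assms(2,4) by (auto simp: inj_on_def tight_path_def nth_eq_iff_index_eq)
  show "(\<lambda>i. p ! (i - 1)) ` verts (tight_path s) \<subseteq> verts G"
    using assms(3,4) by (force simp: tight_path_def)
  have "(p ! (i - 1), p ! (i + 1 - 1), p ! (i + 2 - 1)) \<in> edges G"
    if "1 \<le> i" "i + 2 \<le> s" for i
    using tight_nth[OF assms(1), of "i - 1"] that assms(4)
    by (auto simp: rev_edges_def Suc_diff_Suc numeral_2_eq_2)
  then show "\<forall>(x, y, z)\<in>edges (tight_path s). (p ! (x - 1), p ! (y - 1), p ! (z - 1)) \<in> edges G"
    by (auto simp: tight_path_def)
qed

section \<open>Five vertices with equal labels\<close>

text \<open>Only three of the six orderings are non-edges, so four of them cannot all be
  missing.\<close>

lemma tournament3_two_of: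
  assumes "tournament3 3 G" "{u, v, w} \<subseteq> verts G" "u \<noteq> v" "v \<noteq> w" "u \<noteq> w"
    and "card T = 4" "T \<subseteq> orderings {u, v, w}"
  shows "T \<inter> edges G \<noteq> {}"
proof
  assume T: "T \<inter> edges G = {}"
  have c: "card {u, v, w} = 3" using assms(3-5) by simp
  have "orderings {u, v, w} \<inter> edges G \<subseteq> orderings {u, v, w} - T" using T by auto
  then have "card (orderings {u, v, w} \<inter> edges G) \<le> card (orderings {u, v, w} - T)"
    using card_orderings(1)[OF c] by (intro card_mono) auto
  also have "\<dots> = 2"
    using card_orderings[OF c] assms(6,7) by (simp add: card_Diff_subset finite_subset)
  finally show False using assms(1,2) c by (simp add: tournament3_def)
qed

text \<open>If \<open>e\<close> and \<open>f\<close> were both missing, they and the two monotone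
  orderings would be four non-edges.\<close>

lemma tournament3_nonmonotone:
  fixes u v w :: "'v::linorder"
  assumes "tournament3 3 G" "{u, v, w} \<subseteq> verts G" "u < v" "v < w"
    and "(u, v, w) \<notin> edges G" "(w, v, u) \<notin> edges G"
    and "{e, f} \<subseteq> {(u, w, v), (w, u, v), (v, w, u), (v, u, w)}" "e \<noteq> f"
  shows "e \<in> edges G \<or> f \<in> edges G"
proof -
  define M where "M = {(u, w, v), (w, u, v), (v, w, u), (v, u, w)}"
  have M: "M \<subseteq> orderings {u, v, w}" "(u, v, w) \<notin> M" "(w, v, u) \<notin> M" "{e, f} \<subseteq> M"
    and uw: "{(u, v, w), (w, v, u)} \<subseteq> orderings {u, v, w}" "(u, v, w) \<noteq> (w, v, u)"
    using assms(3,4,7) by (auto simp: orderings_def M_def)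
  then have "card {(u, v, w), (w, v, u), e, f} = 4"
    using assms(8) by (auto simp: card_insert_if)
  moreover have "{(u, v, w), (w, v, u), e, f} \<subseteq> orderings {u, v, w}"
    using M(1,4) uw(1) by blast
  ultimately have "{(u, v, w), (w, v, u), e, f} \<inter> edges G \<noteq> {}"
    by (intro tournament3_two_of) (use assms(1-4) in auto)
  then show ?thesis using assms(5,6) by auto
qed

lemma obtain_five_increasing:
  fixes A :: "'a::linorder set"
  assumes "5 \<le> card A"
  obtains a b c d e where "{a, b, c, d, e} \<subseteq> A" "a < b" "b < c" "c < d" "d < e"
proof -
  have fin: "finite A" using assms by (intro card_ge_0_finite) auto
  define l where "l = sorted_list_of_set A"
  have l: "length l = card A" "set l = A" "sorted_wrt (<) l"
    using fin by (simp_all add: l_def sorted_list_of_set.strict_sorted_key_list_of_set)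
  have step: "l ! i < l ! Suc i" if "i < 4" for i
    using that assms l sorted_wrt_nth_less[of "(<)" l i "Suc i"] by simp
  show thesis
  proof (rule that[of "l ! 0" "l ! 1" "l ! 2" "l ! 3" "l ! 4"])
    show "{l ! 0, l ! 1, l ! 2, l ! 3, l ! 4} \<subseteq> A"
      using assms l(1) nth_mem[of _ l] by (simp add: l(2))
    show "l ! 0 < l ! 1" "l ! 1 < l ! 2" "l ! 2 < l ! 3" "l ! 3 < l ! 4"
      using step[of 0] step[of 1] step[of 2] step[of 3] by (simp_all add: eval_nat_numeral)
  qed
qed

text \<open>In the bound, \<open>s\<^sup>2\<close> counts the pairs of lengths below
  \<open>s\<close>, and \<open>2 * s\<close> bounds the vertices on the two chosen paths. Of the
  \<open>4 * s\<^sup>2 + 2\<close> homogeneous vertices one is a reference point, and the rest force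
  five equal labels.\<close>

lemma tournament3_contains_tight_path:
  fixes G :: "'v::linorder digraph3"
  assumes G: "tournament3 3 G"
    and large: "(s\<^sup>2 * (2 * s + 1) + 1) ^ (4 * s\<^sup>2 + 2) \<le> card (verts G)"
  shows "contains_copy G (tight_path s)"
proof (rule ccontr)
  assume no_path: "\<not> ?thesis"
  define V where "V = verts G"
  define E where "E = edges G"
  define R where "R = rev_edges E"
  have V: "finite V" using G by (simp add: tournament3_def is_digraph3_def V_def)
  have short: "length (longest_to E V u x) < s" "length (longest_to R V u x) < s"
    if "u \<in> V" "x \<in> V" "u < x" for u x
  proof -
    have "longest_to E V u x \<in> paths_to E V u x" "longest_to R V u x \<in> paths_to R V u x"
      by (intro longest_to(1)[OF V that])+
    then have "tight (edges G) (longest_to E V u x)" "tight (rev_edges (edges G)) (longest_to R V u x)"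
      "distinct (longest_to E V u x)" "distinct (longest_to R V u x)"
      "set (longest_to E V u x) \<subseteq> verts G" "set (longest_to R V u x) \<subseteq> verts G"
      unfolding paths_to_def V_def E_def R_def by auto
    then have "\<not> s \<le> length (longest_to E V u x)" "\<not> s \<le> length (longest_to R V u x)"
      using no_path contains_copy_tight[of G "longest_to E V u x" s]
        contains_copy_tight_rev[of G "longest_to R V u x" s] by auto
    then show "length (longest_to E V u x) < s" "length (longest_to R V u x) < s"
      by simp_all
  qed
  define lab where "lab u x = (length (longest_to E V u x), length (longest_to R V u x))" for u x
  define B where "B u x = set (longest_to E V u x) \<union> set (longest_to R V u x)" for u x
  have "\<exists>S\<subseteq>V. card S = 4 * s\<^sup>2 + 2 \<and>
    (\<forall>u\<in>S. \<forall>v\<in>S. \<forall>w\<in>S. u < v \<and> v < w \<longrightarrow> lab u v = lab u w \<and> v \<notin> B u w)"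
  proof (rule homogeneous_subset[OF V])
    have "0 < s" using no_path contains_copy_tight[of G "[]" s] by (cases s) auto
    then show "finite ({..<s} \<times> {..<s})" "{..<s} \<times> {..<s} \<noteq> {}" by auto
    show "lab u x \<in> {..<s} \<times> {..<s}" if "u \<in> V" "x \<in> V" "u < x" for u x
      using short[OF that] by (simp add: lab_def)
    show "finite (B u x) \<and> card (B u x) \<le> 2 * s" if "u \<in> V" "x \<in> V" "u < x" for u x
    proof -
      have "card (B u x) \<le> card (set (longest_to E V u x)) + card (set (longest_to R V u x))"
        unfolding B_def by (rule card_Un_le)
      also have "\<dots> \<le> length (longest_to E V u x) + length (longest_to R V u x)"
        by (intro add_mono card_length)
      finally show ?thesis using short[OF that] by (simp add: B_def)
    qed
    show "(card ({..<s} \<times> {..<s}) * Suc (2 * s) + 1) ^ (4 * s\<^sup>2 + 2) \<le> card V"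
      using large by (simp add: V_def power2_eq_square)
  qed
  then obtain S where S: "S \<subseteq> V" "card S = 4 * s\<^sup>2 + 2"
    and hom: "\<And>u v w. u \<in> S \<Longrightarrow> v \<in> S \<Longrightarrow> w \<in> S \<Longrightarrow> u < v \<Longrightarrow> v < w \<Longrightarrow>
      lab u v = lab u w \<and> v \<notin> B u w"
    by auto
  have fS: "finite S" "S \<noteq> {}" using S by (auto intro: card_ge_0_finite)
  \<comment> \<open>Labels belong to pairs. The top vertex \<open>z\<close> turns them into labels
    of single vertices: by homogeneity \<open>lab u v = lab u z\<close> whenever
    \<open>u < v < z\<close>.\<close>
  define z where "z = Max S"
  have z: "z \<in> S" "\<And>x. x \<in> S - {z} \<Longrightarrow> x < z"
    using fS by (auto simp: z_def order_less_le)
  have cS: "card (S - {z}) = 4 * s\<^sup>2 + 1" using S(2) z(1) fS(1) by simp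
  have range: "(\<lambda>u. lab u z) ` (S - {z}) \<subseteq> {..<s} \<times> {..<s}"
  proof (rule image_subsetI)
    fix u assume "u \<in> S - {z}"
    then show "lab u z \<in> {..<s} \<times> {..<s}"
      using short[of u z] z S(1) by (auto simp: lab_def)
  qed
  have "card (S - {z}) \<noteq> 0" using cS by simp
  then have "S - {z} \<noteq> {}" by (metis card.empty)
  then have "{..<s} \<times> {..<s} \<noteq> {}" using range by blast
  then obtain c where "card (S - {z}) \<le> card ({..<s} \<times> {..<s}) * card {u \<in> S - {z}. lab u z = c}"
    using large_fibre[OF _ _ _ range] fS(1) by blast
  then have c: "4 * s\<^sup>2 + 1 \<le> s\<^sup>2 * card {u \<in> S - {z}. lab u z = c}"
    using cS by (simp add: power2_eq_square)
  have "5 \<le> card {u \<in> S - {z}. lab u z = c}"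
  proof (rule ccontr)
    assume "\<not> ?thesis"
    then have "s\<^sup>2 * card {u \<in> S - {z}. lab u z = c} \<le> s\<^sup>2 * 4" by (intro mult_le_mono2) simp
    then show False using c by linarith
  qed
  then obtain v1 v2 v3 v4 v5 where five: "{v1, v2, v3, v4, v5} \<subseteq> {u \<in> S - {z}. lab u z = c}"
    and less: "v1 < v2" "v2 < v3" "v3 < v4" "v4 < v5"
    by (rule obtain_five_increasing)
  define K where "K = {u \<in> S - {z}. lab u z = c}"
  have KV: "K \<subseteq> V" using S(1) by (auto simp: K_def)
  have len: "length (longest_to E V u v) = fst c" "length (longest_to R V u v) = snd c"
    if "u \<in> K" "v \<in> K" "u < v" for u v
  proof -
    have "lab u v = c" using hom[of u v z] that z by (auto simp: K_def)
    then show "length (longest_to E V u v) = fst c" "length (longest_to R V u v) = snd c"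
      by (auto simp: lab_def)
  qed
  have avoid: "v \<notin> set (longest_to E V u w)" "v \<notin> set (longest_to R V u w)"
    if "{u, v, w} \<subseteq> K" "u < v" "v < w" for u v w
    using hom[of u v w] that by (auto simp: B_def K_def)
  have R: "(x, y, z) \<in> R \<longleftrightarrow> (z, y, x) \<in> E" for x y z
    by (simp add: R_def rev_edges_def)
  have mono: "(u, v, w) \<notin> E" "(w, v, u) \<notin> E" if K: "{u, v, w} \<subseteq> K" "u < v" "v < w" for u v w
  proof -
    \<comment> \<open>Within \<open>K\<close> all lengths agree, so a strict increase is impossible;
      \<open>E\<close> excludes \<open>uvw\<close> and \<open>R\<close> excludes
      \<open>wvu\<close>.\<close>
    note step = length_longest_step[OF V subset_trans[OF K(1) KV] K(2,3)]
    show "(u, v, w) \<notin> E" "(w, v, u) \<notin> E"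
      using step[of E] step[of R] len[of u v] len[of v w] K by (auto simp: R)
  qed
  have zigzag: "\<not> ((u, w, v) \<in> E \<and> (w, v, x) \<in> E)" "\<not> ((v, w, u) \<in> E \<and> (x, v, w) \<in> E)"
    if K: "{u, v, w, x} \<subseteq> K" "u < v" "v < w" "w < x" for u v w x
  proof -
    have av: "v \<notin> set (longest_to E V u w)" "v \<notin> set (longest_to R V u w)"
      using avoid[of u v w] K by auto
    have "u < w" "v < x" using K by auto
    note step = length_longest_zigzag[OF V subset_trans[OF K(1) KV] K(2-4)]
    show "\<not> ((u, w, v) \<in> E \<and> (w, v, x) \<in> E)" "\<not> ((v, w, u) \<in> E \<and> (x, v, w) \<in> E)"
      using step[of E] step[of R] av len[of u w] len[of v x] K(1) \<open>u < w\<close> \<open>v < x\<close>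
      by (auto simp: R)
  qed
  \<comment> \<open>"At most one of the four is missing", written as six disjunctions so that the
    end is purely propositional.\<close>
  have pairs: "((u, w, v) \<in> E \<or> (v, w, u) \<in> E) \<and> ((w, u, v) \<in> E \<or> (v, u, w) \<in> E) \<and>
      ((u, w, v) \<in> E \<or> (w, u, v) \<in> E) \<and> ((v, w, u) \<in> E \<or> (w, u, v) \<in> E) \<and>
      ((u, w, v) \<in> E \<or> (v, u, w) \<in> E) \<and> ((v, w, u) \<in> E \<or> (v, u, w) \<in> E)"
    if uvw: "{u, v, w} \<subseteq> K" "u < v" "v < w" for u v w
  proof -
    have sub: "{u, v, w} \<subseteq> verts G" using uvw(1) KV by (auto simp: V_def)
    have not_E: "(u, v, w) \<notin> edges G" "(w, v, u) \<notin> edges G"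
      using mono[OF uvw] by (simp_all add: E_def)
    note two = tournament3_nonmonotone[OF G sub uvw(2,3) not_E, folded E_def]
    show ?thesis
      by (intro conjI two) (use uvw(2,3) in auto)
  qed
  have K: "{v1, v2, v3} \<subseteq> K" "{v2, v3, v4} \<subseteq> K" "{v3, v4, v5} \<subseteq> K"
    "{v1, v2, v3, v4} \<subseteq> K" "{v2, v3, v4, v5} \<subseteq> K"
    using five by (auto simp: K_def)
  \<comment> \<open>The quadruple \<open>v1, v2, v3, v4\<close> loses one of
    \<open>v1 v3 v2\<close>, \<open>v3 v2 v4\<close> and one of \<open>v2 v3 v1\<close>,
    \<open>v4 v2 v3\<close>. The triple \<open>v1, v2, v3\<close> absorbs at most one loss, so
    \<open>v2, v3, v4\<close> has a loss and keeps both \<open>v2 v4 v3\<close> and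
    \<open>v3 v4 v2\<close>. The quadruple \<open>v2, v3, v4, v5\<close> then forces both
    \<open>v4 v3 v5\<close> and \<open>v5 v3 v4\<close> to be missing, one too many.\<close>
  show False
    using pairs[OF K(1) less(1,2)] pairs[OF K(2) less(2,3)] pairs[OF K(3) less(3,4)]
      zigzag[OF K(4) less(1-3)] zigzag[OF K(5) less(2-4)]
    by argo
qed

section \<open>The growth rate\<close>

text \<open>The exponent 25 is 5 times 5: for \<open>s\<close> at least 2 the base is at most
  \<open>s ^ 5\<close> and the exponent \<open>4 * s\<^sup>2 + 2\<close> at most
  \<open>5 * s\<^sup>2\<close>.\<close>

lemma le_tight_path_number:
  assumes "2 \<le> s" "s ^ (25 * s\<^sup>2) \<le> n"
  shows "s \<le> tight_path_number n 3"
proof -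
  have "s\<^sup>2 * (2 * s + 1) + 1 \<le> s ^ 5"
  proof -
    have sq: "4 \<le> s\<^sup>2" using power_mono[OF assms(1), of 2] by simp
    have "s\<^sup>2 * (2 * s + 1) + 1 = 2 * s ^ 3 + s\<^sup>2 + 1" by (simp add: eval_nat_numeral algebra_simps)
    also have "\<dots> \<le> s ^ 3 * 4"
      using mult_le_mono2[OF assms(1), of "s\<^sup>2"] sq by (simp add: eval_nat_numeral)
    also have "\<dots> \<le> s ^ 3 * s\<^sup>2" using sq by (rule mult_le_mono2)
    also have "\<dots> = s ^ 5" by (simp flip: power_add)
    finally show ?thesis .
  qed
  then have "(s\<^sup>2 * (2 * s + 1) + 1) ^ (4 * s\<^sup>2 + 2) \<le> (s ^ 5) ^ (4 * s\<^sup>2 + 2)"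
    by (rule power_mono) simp
  also have "\<dots> \<le> (s ^ 5) ^ (5 * s\<^sup>2)"
    using assms(1) power_mono[OF assms(1), of 2] by (intro power_increasing) auto
  also have "\<dots> \<le> n" using assms(2) by (simp flip: power_mult)
  finally have "path_forced TYPE(nat) n 3 s"
    unfolding path_forced_def using tournament3_contains_tight_path by blast
  then show ?thesis
    unfolding tight_path_number_def using path_forced_finite[of 3 n] by (intro Max_ge) auto
qed

theorem theorem28:
  shows "\<exists>c :: real. c > 0 \<and> (\<exists>n\<^sub>0 :: nat. \<forall>n \<ge> n\<^sub>0.
           real (tight_path_number n 3) \<ge> c * (ln (real n) / ln (ln (real n))) powr (1 / 2))"
proof -
  define y where "y n = (ln (real n) / ln (ln (real n))) powr (1 / 2)" for n :: nat
  have "\<forall>\<^sub>F n in sequentially. y n \<ge> 10" "\<forall>\<^sub>F n::nat in sequentially. ln (ln (real n)) \<ge> 1"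
    "\<forall>\<^sub>F n::nat in sequentially. ln (real n) \<ge> 1"
    unfolding y_def by real_asymp+
  then have "\<forall>\<^sub>F n in sequentially. y n / 10 \<le> real (tight_path_number n 3)"
    using eventually_gt_at_top[of 0]
  proof eventually_elim
    case (elim n)
    \<comment> \<open>Division by 5 gives \<open>25 * s\<^sup>2\<close> at most
      \<open>(y n)\<^sup>2\<close>. As \<open>y n\<close> is at least 10, rounding down loses at
      most a factor 2, whence the final constant 1/10.\<close>
    define s where "s = nat \<lfloor>y n / 5\<rfloor>"
    have s: "2 \<le> s" "real s \<le> y n / 5" "y n / 10 \<le> real s"
      using elim(1) unfolding s_def by linarith+
    have y2: "(y n)\<^sup>2 = ln n / ln (ln n)"
      using elim(2,3) by (simp add: y_def powr_half_sqrt)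
    \<comment> \<open>This crude bound lets the factor \<open>ln s\<close> cancel the denominator of
      \<open>(y n)\<^sup>2\<close>.\<close>
    have "ln s \<le> ln (ln n)"
    proof -
      have "(real s)\<^sup>2 \<le> (y n)\<^sup>2" using s(2) elim(1) by (intro power_mono) auto
      also have "\<dots> \<le> ln n" using elim(2,3) by (simp add: y2 divide_le_eq mult_le_cancel_left1)
      finally have "(real s)\<^sup>2 \<le> ln n" .
      moreover have "real s \<le> (real s)\<^sup>2" using s(1) by (simp add: power2_eq_square)
      ultimately have "real s \<le> ln n" by linarith
      then show ?thesis using s(1) by (intro ln_mono) auto
    qed
    moreover have "25 * (real s)\<^sup>2 \<le> (y n)\<^sup>2"
      using power_mono[OF s(2), of 2] by (simp add: power_divide)
    ultimately have "25 * (real s)\<^sup>2 * ln s \<le> (y n)\<^sup>2 * ln (ln n)"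
      using s(1) by (intro mult_mono) auto
    also have "\<dots> = ln n" using elim(2) by (simp add: y2)
    finally have "ln (real s ^ (25 * s\<^sup>2)) \<le> ln (real n)"
      using s(1) by (simp add: ln_realpow)
    then have "real s ^ (25 * s\<^sup>2) \<le> real n"
      using s(1) elim(4) by simp
    then have "s ^ (25 * s\<^sup>2) \<le> n"
      by (metis of_nat_le_iff of_nat_power)
    then show ?case using le_tight_path_number[OF s(1)] s(3) by fastforce
  qed
  then show ?thesis
    unfolding eventually_sequentially y_def by (intro exI[of _ "1 / 10"]) auto
qed

end
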